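(* Let $\mathcal{X}$ be a finite dimensional complex Banach space and let $T\in\mathcal{L}(\mathcal{X})$ be Moore-Penrose invertible with Moore-Penrose inverse $T^{\dagger}$. The following statements are equivalent. (i) $T$ is co-EP; (ii) $\mathcal{R}(T)\cap\mathcal{R}(T^{\dagger})=0$ and $\mathcal{N}(T)\cap\mathcal{N}(T^{\dagger})=0$; (iii) $\mathcal{X}=\mathcal{R}(T)+\mathcal{R}(T^{\dagger})$ and $\mathcal{X}=\mathcal{N}(T)+\mathcal{N}(T^{\dagger})$.
   Context: $\mathcal{L}(\mathcal{X})$ is the unital Banach algebra of bounded linear maps on the complex Banach space $\mathcal{X}$ (with the operator norm); $\mathcal{N}(T)$ and $\mathcal{R}(T)$ denote the null space and range of $T$. In a unital complex Banach algebra $\mathcal{A}$, an element $c$ is hermitian if $\|\exp(itc)\|=1$ for all $t\in\mathbb{R}$; an element $a$ is Moore-Penrose invertible if there exists $x\in\mathcal{A}$ with $axa=a$, $xax=x$ and both $ax$ and $xa$ hermitian; such $x$ is unique, is called the Moore-Penrose inverse of $a$ and is denoted $a^{\dagger}$. A Moore-Penrose invertible element $a$ is co-EP if $aa^{\dagger}-a^{\dagger}a$ is invertible in $\mathcal{A}$. These notions are applied with $\mathcal{A}=\mathcal{L}(\mathcal{X})$. The symbol $0$ also denotes the zero subspace. *)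

theory Defs
  imports "HOL-Analysis.Analysis"
begin

section \<open>Complex Banach spaces and complex Banach algebras\<close>

class scaleC =
  fixes scaleC :: "complex \<Rightarrow> 'a \<Rightarrow> 'a" (infixr \<open>*\<^sub>C\<close> 75)

class complex_vector = real_vector + scaleC +
  assumes scaleC_add_right: "a *\<^sub>C (x + y) = a *\<^sub>C x + a *\<^sub>C y"
    and scaleC_add_left: "(a + b) *\<^sub>C x = a *\<^sub>C x + b *\<^sub>C x"
    and scaleC_scaleC: "a *\<^sub>C b *\<^sub>C x = (a * b) *\<^sub>C x"
    and scaleC_one: "1 *\<^sub>C x = x"
    and scaleR_scaleC: "r *\<^sub>R x = complex_of_real r *\<^sub>C x"

lemma vector_space_scaleC: "vector_space (scaleC :: complex \<Rightarrow> 'a \<Rightarrow> 'a::complex_vector)"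
  by unfold_locales (simp_all add: scaleC_add_right scaleC_add_left scaleC_scaleC scaleC_one)

class complex_normed_vector = complex_vector + real_normed_vector +
  assumes norm_scaleC: "norm (a *\<^sub>C x) = cmod a * norm x"

class complex_banach = complex_normed_vector + banach

instantiation complex :: complex_banach
begin

definition scaleC_complex :: "complex \<Rightarrow> complex \<Rightarrow> complex"
  where "scaleC_complex = (*)"

instance
  by standard (simp_all add: scaleC_complex_def algebra_simps norm_mult scaleR_conv_of_real)

end

text \<open>
  Neither \<open>0 \<noteq> 1\<close> nor \<open>norm 1 = 1\<close> is required, so that the bounded operators on the zero
  space are included. Wherever a hermitian element exists, \<open>norm 1 = 1\<close> follows by taking
  \<open>t = 0\<close> in the definition of hermitian below.
\<close>

class unital_complex_banach_algebra = complex_banach + real_normed_algebra + monoid_mult +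
  assumes mult_scaleC_left: "(a *\<^sub>C x) * y = a *\<^sub>C (x * y)"
    and mult_scaleC_right: "x * (a *\<^sub>C y) = a *\<^sub>C (x * y)"

text \<open>
  The library constant \<open>exp\<close> is restricted to \<open>real_normed_algebra_1\<close>, which excludes the zero
  algebra; the following is the same series.
\<close>

definition banach_exp :: "'a::{real_normed_algebra, monoid_mult, banach} \<Rightarrow> 'a"
  where "banach_exp a = (\<Sum>n. a ^ n /\<^sub>R fact n)"

lemma banach_exp_eq_exp:
  fixes a :: "'a::{real_normed_algebra_1, banach}"
  shows "banach_exp a = exp a"
  by (simp add: banach_exp_def exp_def)

section \<open>Hermitian, Moore-Penrose invertible and co-EP elements\<close>

definition hermitian :: "'a::unital_complex_banach_algebra \<Rightarrow> bool"
  where "hermitian c \<longleftrightarrow> (\<forall>t::real. norm (banach_exp ((\<i> * complex_of_real t) *\<^sub>C c)) = 1)"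

definition algebra_invertible :: "'a::monoid_mult \<Rightarrow> bool"
  where "algebra_invertible a \<longleftrightarrow> (\<exists>b. a * b = 1 \<and> b * a = 1)"

definition is_Moore_Penrose_inverse :: "'a::unital_complex_banach_algebra \<Rightarrow> 'a \<Rightarrow> bool"
  where "is_Moore_Penrose_inverse a x \<longleftrightarrow>
    a * x * a = a \<and> x * a * x = x \<and> hermitian (a * x) \<and> hermitian (x * a)"

definition Moore_Penrose_invertible :: "'a::unital_complex_banach_algebra \<Rightarrow> bool"
  where "Moore_Penrose_invertible a \<longleftrightarrow> (\<exists>x. is_Moore_Penrose_inverse a x)"

definition Moore_Penrose_inverse :: "'a::unital_complex_banach_algebra \<Rightarrow> 'a"
    (\<open>(_\<^sup>\<dagger>)\<close> [1000] 999)
  where "a\<^sup>\<dagger> = (THE x. is_Moore_Penrose_inverse a x)"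

definition co_EP :: "'a::unital_complex_banach_algebra \<Rightarrow> bool"
  where "co_EP a \<longleftrightarrow> Moore_Penrose_invertible a \<and> algebra_invertible (a * a\<^sup>\<dagger> - a\<^sup>\<dagger> * a)"

section \<open>The Banach algebra of bounded complex-linear operators\<close>

typedef (overloaded) 'a coperator =
  "{T :: 'a::complex_banach \<Rightarrow>\<^sub>L 'a. \<forall>c x. blinfun_apply T (c *\<^sub>C x) = c *\<^sub>C blinfun_apply T x}"
  morphisms blinfun_of_coperator Abs_coperator
  by (rule exI[of _ 0]) (simp add: norm_scaleC flip: norm_eq_zero)

setup_lifting type_definition_coperator

lift_definition coperator_apply :: "'a::complex_banach coperator \<Rightarrow> 'a \<Rightarrow> 'a"
  is blinfun_apply .

definition null_space :: "'a::complex_banach coperator \<Rightarrow> 'a set"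
  where "null_space T = {x. coperator_apply T x = 0}"

definition range_space :: "'a::complex_banach coperator \<Rightarrow> 'a set"
  where "range_space T = range (coperator_apply T)"

lemma scaleC_zero_right: "c *\<^sub>C (0::'a::complex_vector) = 0"
  using scaleC_add_right[of c "0::'a" 0] by simp

lemma scaleC_minus_right: "c *\<^sub>C (- x) = - (c *\<^sub>C (x::'a::complex_vector))"
  using scaleC_add_right[of c x "- x"] by (simp add: scaleC_zero_right eq_neg_iff_add_eq_0 add.commute)

lemma scaleC_diff_right: "c *\<^sub>C (x - y) = c *\<^sub>C x - c *\<^sub>C (y::'a::complex_vector)"
  using scaleC_add_right[of c x "- y"] by (simp add: scaleC_minus_right)

lemma scaleC_scaleR_commute: "c *\<^sub>C r *\<^sub>R x = r *\<^sub>R c *\<^sub>C (x::'a::complex_vector)"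
  by (simp add: scaleR_scaleC scaleC_scaleC mult.commute)

lemma bounded_linear_scaleC: "bounded_linear (\<lambda>x::'a::complex_normed_vector. c *\<^sub>C x)"
  by (rule bounded_linear_intro[where K = "cmod c"])
    (simp_all add: scaleC_add_right scaleC_scaleR_commute norm_scaleC mult.commute)

instantiation coperator :: (complex_banach) real_normed_vector
begin

lift_definition zero_coperator :: "'a coperator" is 0
  by (simp add: scaleC_zero_right)

lift_definition plus_coperator :: "'a coperator \<Rightarrow> 'a coperator \<Rightarrow> 'a coperator" is "(+)"
  by (simp add: blinfun.bilinear_simps scaleC_add_right)

lift_definition minus_coperator :: "'a coperator \<Rightarrow> 'a coperator \<Rightarrow> 'a coperator" is "(-)"
  by (simp add: blinfun.bilinear_simps scaleC_diff_right)

lift_definition uminus_coperator :: "'a coperator \<Rightarrow> 'a coperator" is uminus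
  by (simp add: blinfun.bilinear_simps scaleC_minus_right)

lift_definition scaleR_coperator :: "real \<Rightarrow> 'a coperator \<Rightarrow> 'a coperator" is scaleR
  by (simp add: blinfun.bilinear_simps scaleC_scaleR_commute)

lift_definition norm_coperator :: "'a coperator \<Rightarrow> real" is norm .

definition dist_coperator :: "'a coperator \<Rightarrow> 'a coperator \<Rightarrow> real"
  where "dist_coperator S T = norm (S - T)"

definition sgn_coperator :: "'a coperator \<Rightarrow> 'a coperator"
  where "sgn_coperator T = scaleR (inverse (norm T)) T"

definition uniformity_coperator :: "('a coperator \<times> 'a coperator) filter"
  where "uniformity_coperator = (INF e\<in>{0 <..}. principal {(S, T). dist S T < e})"

definition open_coperator :: "'a coperator set \<Rightarrow> bool"
  where "open_coperator U =
    (\<forall>S\<in>U. eventually (\<lambda>(S', T). S' = S \<longrightarrow> T \<in> U) uniformity)"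

instance
proof
  fix S T U :: "'a coperator" and a b :: real
  show "S + T + U = S + (T + U)" "S + T = T + S" "0 + S = S" "- S + S = 0" "S - T = S + - T"
    by (transfer; simp)+
  show "a *\<^sub>R (S + T) = a *\<^sub>R S + a *\<^sub>R T" "(a + b) *\<^sub>R S = a *\<^sub>R S + b *\<^sub>R S"
    "a *\<^sub>R b *\<^sub>R S = (a * b) *\<^sub>R S" "1 *\<^sub>R S = S"
    by (transfer; simp add: algebra_simps)+
  show "sgn S = scaleR (inverse (norm S)) S" by (rule sgn_coperator_def)
  show "dist S T = norm (S - T)" by (rule dist_coperator_def)
  show "norm S = 0 \<longleftrightarrow> S = 0" "norm (a *\<^sub>R S) = \<bar>a\<bar> * norm S"
    by (transfer; simp)+
  show "norm (S + T) \<le> norm S + norm T"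
    by transfer (rule norm_triangle_ineq)
qed (simp_all add: uniformity_coperator_def open_coperator_def)

end

instance coperator :: (complex_banach) banach
proof
  fix X :: "nat \<Rightarrow> 'a coperator"
  let ?Y = "\<lambda>n. blinfun_of_coperator (X n)"
  have dist_eq: "dist (blinfun_of_coperator S) (blinfun_of_coperator T) = dist S T"
    for S T :: "'a coperator"
    by (simp add: dist_norm norm_coperator.rep_eq minus_coperator.rep_eq)
  assume "Cauchy X"
  then have "Cauchy ?Y"
    by (simp add: Cauchy_def dist_eq)
  then obtain L where L: "?Y \<longlonglongrightarrow> L"
    by (auto simp: Cauchy_convergent_iff convergent_def)
  have "blinfun_apply L (c *\<^sub>C x) = c *\<^sub>C blinfun_apply L x" for c x
  proof (rule LIMSEQ_unique)
    have lim: "(\<lambda>n. blinfun_apply (?Y n) y) \<longlonglongrightarrow> blinfun_apply L y" for y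
      by (intro blinfun.tendsto L tendsto_const)
    show "(\<lambda>n. blinfun_apply (?Y n) (c *\<^sub>C x)) \<longlonglongrightarrow> blinfun_apply L (c *\<^sub>C x)"
      by (rule lim)
    have "(\<lambda>n. c *\<^sub>C blinfun_apply (?Y n) x) \<longlonglongrightarrow> c *\<^sub>C blinfun_apply L x"
      by (rule bounded_linear.tendsto[OF bounded_linear_scaleC lim])
    then show "(\<lambda>n. blinfun_apply (?Y n) (c *\<^sub>C x)) \<longlonglongrightarrow> c *\<^sub>C blinfun_apply L x"
      by (simp add: blinfun_of_coperator[simplified])
  qed
  then have "blinfun_of_coperator (Abs_coperator L) = L"
    by (simp add: Abs_coperator_inverse)
  then have "X \<longlonglongrightarrow> Abs_coperator L"
    using L by (simp add: lim_sequentially flip: dist_eq)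
  then show "convergent X"
    by (rule convergentI)
qed

instantiation coperator :: (complex_banach) unital_complex_banach_algebra
begin

lift_definition scaleC_coperator :: "complex \<Rightarrow> 'a coperator \<Rightarrow> 'a coperator"
  is "\<lambda>c T. Blinfun (\<lambda>x. c *\<^sub>C x) o\<^sub>L T"
  by (simp add: bounded_linear_Blinfun_apply bounded_linear_scaleC scaleC_scaleC mult.commute)

lift_definition one_coperator :: "'a coperator" is id_blinfun
  by simp

lift_definition times_coperator :: "'a coperator \<Rightarrow> 'a coperator \<Rightarrow> 'a coperator" is "(o\<^sub>L)"
  by simp

instance
proof
  fix S T U :: "'a coperator" and a b :: complex and r :: real
  note [simp] = bounded_linear_Blinfun_apply bounded_linear_scaleC
  show "a *\<^sub>C (S + T) = a *\<^sub>C S + a *\<^sub>C T" "(a + b) *\<^sub>C S = a *\<^sub>C S + b *\<^sub>C S"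
    "a *\<^sub>C b *\<^sub>C S = (a * b) *\<^sub>C S" "1 *\<^sub>C S = S" "r *\<^sub>R S = complex_of_real r *\<^sub>C S"
    by (transfer; rule blinfun_eqI; simp add: blinfun.bilinear_simps scaleC_add_right
        scaleC_add_left scaleC_scaleC scaleC_one scaleR_scaleC)+
  have le: "norm (c *\<^sub>C V) \<le> cmod c * norm V" for c and V :: "'a coperator"
  proof (transfer, rule norm_blinfun_bound)
    fix c and V :: "'a \<Rightarrow>\<^sub>L 'a" and x
    show "norm (blinfun_apply (Blinfun ((*\<^sub>C) c) o\<^sub>L V) x) \<le> cmod c * norm V * norm x"
      by (simp add: norm_scaleC mult.assoc mult_left_mono norm_blinfun)
  qed simp
  show "norm (a *\<^sub>C S) = cmod a * norm S"
  proof (cases "a = 0")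
    case True
    with le[of a S] show ?thesis by simp
  next
    case False
    have "S = inverse a *\<^sub>C a *\<^sub>C S"
      using False by transfer (rule blinfun_eqI, simp add: scaleC_scaleC scaleC_one)
    then have "norm S \<le> cmod (inverse a) * norm (a *\<^sub>C S)"
      using le[of "inverse a" "a *\<^sub>C S"] by simp
    then have "cmod a * norm S \<le> norm (a *\<^sub>C S)"
      using False mult_left_mono[of "norm S" _ "cmod a"]
      by (fastforce simp: norm_inverse simp flip: mult.assoc)
    with le[of a S] show ?thesis by simp
  qed
  show "S * T * U = S * (T * U)" "1 * S = S" "S * 1 = S"
    "(S + T) * U = S * U + T * U" "S * (T + U) = S * T + S * U"
    "(r *\<^sub>R S) * T = r *\<^sub>R (S * T)" "S * (r *\<^sub>R T) = r *\<^sub>R (S * T)"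
    by (transfer; rule blinfun_eqI; simp add: blinfun.bilinear_simps)+
  show "norm (S * T) \<le> norm S * norm T"
    by transfer (rule norm_blinfun_compose)
  show "(a *\<^sub>C S) * T = a *\<^sub>C (S * T)" "S * (a *\<^sub>C T) = a *\<^sub>C (S * T)"
    by (transfer; rule blinfun_eqI; simp)+
qed

end

lemma coperator_apply_scaleC: "coperator_apply (c *\<^sub>C T) x = c *\<^sub>C coperator_apply T x"
  by transfer (simp add: bounded_linear_Blinfun_apply bounded_linear_scaleC)

lemma coperator_apply_times: "coperator_apply (S * T) x = coperator_apply S (coperator_apply T x)"
  by transfer simp

lemma norm_coperator_onorm: "norm T = onorm (coperator_apply T)"
  by transfer (rule norm_blinfun.rep_eq)

text \<open>
  The library constant for addition of sets, \<open>A + B = {a + b | a b. a \<in> A \<and> b \<in> B}\<close>, serves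
  as the (not necessarily direct) sum of subspaces.
\<close>

end

theory Submission
  imports Defs
begin

text \<open>
  Write \<open>P = T T\<^sup>\<dagger>\<close> and \<open>Q = T\<^sup>\<dagger> T\<close>, idempotents with the ranges of \<open>T\<close>, \<open>T\<^sup>\<dagger>\<close> and the null spaces
  of \<open>T\<^sup>\<dagger>\<close>, \<open>T\<close>. If \<open>P x = Q x\<close>, this vector lies in both ranges, so (ii) makes \<open>P - Q\<close> injective.
  If \<open>N P + N Q\<close> is the whole space, then \<open>(P - Q) (N Q) = P (N Q) = R P\<close> and likewise for \<open>R Q\<close>,
  so (iii) makes \<open>P - Q\<close> surjective. Conversely \<open>P x - Q x = (1 - Q) x - (1 - P) x\<close>. Hermitianness
  enters only through the uniqueness of \<open>T\<^sup>\<dagger>\<close>: two Moore-Penrose inverses yield hermitian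
  idempotents \<open>p\<close>, \<open>q\<close> with \<open>(p - q)\<^sup>2 = 0\<close> for which \<open>(1 - 2p)(1 - 2q)\<close> is \<open>1 \<plusminus> 2(p - q)\<close>,
  and a contraction \<open>1 + h\<close> with \<open>h\<^sup>2 = 0\<close> has \<open>h = 0\<close>.
\<close>

section \<open>Hermitian idempotents and uniqueness of the Moore-Penrose inverse\<close>

lemma bounded_linear_scaleC_left:
  "bounded_linear (\<lambda>c. c *\<^sub>C (x::'a::complex_normed_vector))"
  by (rule bounded_linear_intro[where K = "norm x"])
    (simp_all add: scaleC_add_left norm_scaleC scaleR_scaleC scaleC_scaleC scaleC_complex_def)

lemma scaleC_minus_left: "(- c) *\<^sub>C x = - (c *\<^sub>C (x::'a::complex_normed_vector))"
  by (rule linear_neg[OF bounded_linear.linear[OF bounded_linear_scaleC_left]])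

lemma scaleC_diff_left: "(c - d) *\<^sub>C x = c *\<^sub>C x - d *\<^sub>C (x::'a::complex_normed_vector)"
  by (rule linear_diff[OF bounded_linear.linear[OF bounded_linear_scaleC_left]])

lemma banach_exp_idempotent:
  fixes p :: "'a::unital_complex_banach_algebra"
  assumes "p * p = p"
  shows "banach_exp (c *\<^sub>C p) = 1 + (exp c - 1) *\<^sub>C p"
proof -
  have pow: "(c *\<^sub>C p) ^ Suc n = c ^ Suc n *\<^sub>C p" for n
    by (induction n) (simp_all add: mult_scaleC_left mult_scaleC_right assms scaleC_scaleC mult.commute)
  \<comment> \<open>All positive powers of \<open>c *\<^sub>C p\<close> are multiples of
    \<open>p\<close>, but the zeroth is \<open>1\<close>; the extra term \<open>1 - p\<close> at
    \<open>n = 0\<close> corrects this.\<close>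
  have "(\<lambda>n. (c ^ n /\<^sub>R fact n) *\<^sub>C p + (if n = 0 then 1 - p else 0))
      sums (exp c *\<^sub>C p + (1 - p))"
    by (intro sums_add bounded_linear.sums[OF bounded_linear_scaleC_left] exp_converges)
      (use sums_single[of 0 "\<lambda>_. 1 - p"] in simp)
  moreover have "(c ^ n /\<^sub>R fact n) *\<^sub>C p + (if n = 0 then 1 - p else 0) = (c *\<^sub>C p) ^ n /\<^sub>R fact n"
    for n
    using pow[of "n - 1"]
    by (cases n) (simp_all add: scaleC_one scaleR_scaleC scaleC_scaleC scaleC_complex_def)
  ultimately have "(\<lambda>n. (c *\<^sub>C p) ^ n /\<^sub>R fact n) sums (exp c *\<^sub>C p + (1 - p))"
    by simp
  then show ?thesis
    by (simp add: banach_exp_def sums_iff scaleC_diff_left scaleC_one)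
qed

text \<open>Take \<open>t = pi\<close> in the definition of hermitian: since
  \<open>exp (\<i> * pi) = - 1\<close>, the exponential is exactly this reflection.\<close>

lemma norm_hermitian_reflection:
  fixes p :: "'a::unital_complex_banach_algebra"
  assumes "hermitian p" "p * p = p"
  shows "norm (1 - 2 *\<^sub>R p) = 1"
proof -
  have "norm (1 + (exp (\<i> * complex_of_real pi) - 1) *\<^sub>C p) = 1"
    unfolding banach_exp_idempotent[OF assms(2), symmetric]
    using assms(1) by (simp only: hermitian_def)
  moreover have "exp (\<i> * complex_of_real pi) - 1 = - complex_of_real 2"
    by (simp add: mult.commute)
  ultimately show ?thesis
    by (simp add: scaleC_minus_left scaleR_scaleC)
qed

text \<open>The powers \<open>1 + n h\<close> of \<open>1 + h\<close> stay bounded, whereas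
  \<open>n h\<close> grows without bound unless \<open>h = 0\<close>.\<close>

lemma square_zero_contraction:
  fixes h :: "'a::unital_complex_banach_algebra"
  assumes "h * h = 0" "norm (1 + h) \<le> 1"
  shows "h = 0"
proof (rule ccontr)
  assume "h \<noteq> 0"
  have pow: "(1 + h) ^ n = 1 + real n *\<^sub>R h" for n
    by (induction n) (simp_all add: algebra_simps assms(1))
  \<comment> \<open>Exponents start at one because the algebra class does not bound
    \<open>norm 1\<close> by one.\<close>
  have le1: "norm ((1 + h) ^ Suc n) \<le> 1" for n
  proof (induction n)
    case (Suc n)
    have "norm ((1 + h) ^ Suc (Suc n)) \<le> norm (1 + h) * norm ((1 + h) ^ Suc n)"
      unfolding power_Suc[of _ "Suc n"] by (rule norm_mult_ineq)
    also have "\<dots> \<le> 1"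
      using Suc assms(2) by (intro mult_le_one) auto
    finally show ?case .
  qed (use assms(2) in simp)
  obtain n where n: "real n * norm h > 1 + norm (1::'a)"
    using reals_Archimedean3[of "norm h"] \<open>h \<noteq> 0\<close> by auto
  have "real (Suc n) * norm h = norm ((1 + h) ^ Suc n - 1)"
    unfolding pow by simp
  also have "\<dots> \<le> norm ((1 + h) ^ Suc n) + norm (1::'a)"
    by (rule norm_triangle_ineq4)
  finally have "real (Suc n) * norm h \<le> 1 + norm (1::'a)"
    using le1[of n] by simp
  moreover have "real n * norm h \<le> real (Suc n) * norm h"
    by (simp add: mult_right_mono)
  ultimately show False
    using n by linarith
qed

text \<open>The two alternatives say that \<open>p\<close> and \<open>q\<close> generate the same
  right ideal or the same left ideal; for operators, that they share their range or their null
  space. The first fits \<open>a * x\<close> and \<open>a * y\<close>, the second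
  \<open>x * a\<close> and \<open>y * a\<close>.\<close>

lemma hermitian_idempotents_eqI:
  fixes p q :: "'a::unital_complex_banach_algebra"
  assumes "hermitian p" "p * p = p" "hermitian q" "q * q = q"
    and "p * q = q \<and> q * p = p \<or> p * q = p \<and> q * p = q"
  shows "p = q"
proof -
  define h where "h = (1 - 2 *\<^sub>R p) * (1 - 2 *\<^sub>R q) - 1"
  have h: "h = 2 *\<^sub>R (q - p) \<or> h = 2 *\<^sub>R (p - q)"
    using assms(5) by (auto simp: h_def algebra_simps simp flip: scaleR_add_left)
  have "norm (1 + h) \<le> norm (1 - 2 *\<^sub>R p) * norm (1 - 2 *\<^sub>R q)"
    unfolding h_def using norm_mult_ineq by simp
  then have "norm (1 + h) \<le> 1"
    by (simp add: norm_hermitian_reflection assms)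
  moreover have "h * h = 0"
  proof -
    have "(p - q) * (p - q) = 0"
      using assms(2,4,5) by (elim disjE conjE) (simp_all add: left_diff_distrib right_diff_distrib)
    moreover have "h = 2 *\<^sub>R (p - q) \<or> h = (- 2) *\<^sub>R (p - q)"
      using h by (metis minus_diff_eq scaleR_minus_left scaleR_minus_right)
    ultimately show ?thesis
      by (elim disjE) simp_all
  qed
  ultimately have "h = 0"
    by (rule square_zero_contraction[rotated])
  with h show ?thesis
    by auto
qed

lemma is_Moore_Penrose_inverse_unique:
  assumes x: "is_Moore_Penrose_inverse a x" and y: "is_Moore_Penrose_inverse a y"
  shows "x = y"
proof -
  note eqs = x[unfolded is_Moore_Penrose_inverse_def] y[unfolded is_Moore_Penrose_inverse_def]
  have "a * x = a * y"
    by (rule hermitian_idempotents_eqI) (use eqs in \<open>auto simp flip: mult.assoc\<close>)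
  moreover have "x * a = y * a"
    by (rule hermitian_idempotents_eqI) (use eqs in \<open>auto simp: mult.assoc\<close>)
  \<comment> \<open>The chain is \<open>x = x a x = x a y = y a y = y\<close>.\<close>
  ultimately show ?thesis
    using eqs by (metis mult.assoc)
qed

lemma is_Moore_Penrose_inverse_dagger:
  assumes "Moore_Penrose_invertible a"
  shows "is_Moore_Penrose_inverse a (a\<^sup>\<dagger>)"
  using assms theI'[of "is_Moore_Penrose_inverse a"] is_Moore_Penrose_inverse_unique
  unfolding Moore_Penrose_invertible_def Moore_Penrose_inverse_def by blast

section \<open>Invertibility of operators in finite dimension\<close>

lemma coperator_eqI: "(\<And>x. coperator_apply S x = coperator_apply T x) \<Longrightarrow> S = T"
  by transfer (rule blinfun_eqI)

lemma coperator_apply_simps: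
  "coperator_apply (S + T) x = coperator_apply S x + coperator_apply T x"
  "coperator_apply (S - T) x = coperator_apply S x - coperator_apply T x"
  "coperator_apply 1 x = x"
  "coperator_apply 0 x = 0"
  by (transfer; simp add: blinfun.bilinear_simps)+

lemma linear_coperator_apply:
  "Vector_Spaces.linear scaleC scaleC (coperator_apply T)"
proof -
  interpret vector_space "scaleC :: complex \<Rightarrow> 'a \<Rightarrow> 'a"
    by (rule vector_space_scaleC)
  show ?thesis
    by unfold_locales (transfer; simp add: blinfun.bilinear_simps)+
qed

text \<open>
  The vectors \<open>U x\<close> with \<open>U\<close> in the commutant of \<open>D\<close> form a finite-dimensional subspace that
  the injective \<open>D\<close> maps to itself, hence onto itself.
\<close>

lemma exists_commuting_local_inverse:
  fixes D :: "'a::complex_banach coperator"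
  assumes fin: "finite_dimensional_vector_space (scaleC :: complex \<Rightarrow> 'a \<Rightarrow> 'a) B"
    and inj: "inj (coperator_apply D)"
  shows "\<exists>U. U * D = D * U \<and> coperator_apply (U * D) x = x"
proof -
  interpret finite_dimensional_vector_space "scaleC :: complex \<Rightarrow> 'a \<Rightarrow> 'a" B
    by (rule fin)
  interpret finite_dimensional_vector_space_pair
    "scaleC :: complex \<Rightarrow> 'a \<Rightarrow> 'a" B "scaleC :: complex \<Rightarrow> 'a \<Rightarrow> 'a" B
    by unfold_locales
  note D = linear_coperator_apply[of D]
  define W where "W = {coperator_apply U x | U. U * D = D * U}"
  have WI: "coperator_apply U x \<in> W" if "U * D = D * U" for U
    using that by (auto simp: W_def)
  have W: "subspace W"
  proof (rule subspaceI)
    show "0 \<in> W"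
      using WI[of 0] by (simp add: coperator_apply_simps)
    show "u + v \<in> W" if "u \<in> W" "v \<in> W" for u v
    proof -
      from that obtain U V where "U * D = D * U" "V * D = D * V"
        "u = coperator_apply U x" "v = coperator_apply V x"
        unfolding W_def by blast
      then show ?thesis
        using WI[of "U + V"] by (simp add: coperator_apply_simps algebra_simps)
    qed
    show "c *\<^sub>C u \<in> W" if "u \<in> W" for c u
    proof -
      from that obtain U where "U * D = D * U" "u = coperator_apply U x"
        unfolding W_def by blast
      then show ?thesis
        using WI[of "c *\<^sub>C U"]
        by (simp add: coperator_apply_scaleC mult_scaleC_left mult_scaleC_right)
    qed
  qed
  have "coperator_apply D ` W \<subseteq> W"
  proof
    fix y assume "y \<in> coperator_apply D ` W"
    then obtain U where "U * D = D * U" "y = coperator_apply D (coperator_apply U x)"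
      unfolding W_def by blast
    then show "y \<in> W"
      using WI[of "D * U"] by (simp add: coperator_apply_times mult.assoc)
  qed
  moreover have "dim (coperator_apply D ` W) = dim W"
    by (rule dim_image_eq[OF D]) (rule inj_on_subset[OF inj subset_UNIV])
  ultimately have "coperator_apply D ` W = W"
    by (intro subspace_dim_equal linear_subspace_image[OF D] W) auto
  moreover have "x \<in> W"
    using WI[of 1] by (simp add: coperator_apply_simps)
  ultimately obtain U where "U * D = D * U" "x = coperator_apply D (coperator_apply U x)"
    unfolding W_def by blast
  then show ?thesis
    by (metis coperator_apply_times)
qed

text \<open>
  Local inverses are glued along a basis with \<open>1 - S' D = (1 - U D) (1 - S D)\<close>; staying inside
  the algebra of operators avoids proving that the algebraic inverse is bounded.
\<close>

lemma injective_coperator_invertible: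
  fixes D :: "'a::complex_banach coperator"
  assumes fin: "finite_dimensional_vector_space (scaleC :: complex \<Rightarrow> 'a \<Rightarrow> 'a) B"
    and inj: "inj (coperator_apply D)"
  shows "algebra_invertible D"
proof -
  interpret finite_dimensional_vector_space "scaleC :: complex \<Rightarrow> 'a \<Rightarrow> 'a" B
    by (rule fin)
  interpret vector_space_pair "scaleC :: complex \<Rightarrow> 'a \<Rightarrow> 'a" "scaleC :: complex \<Rightarrow> 'a \<Rightarrow> 'a"
    by unfold_locales
  have "\<exists>S. S * D = D * S \<and> (\<forall>x\<in>F. coperator_apply (S * D) x = x)" if "finite F" for F
    using that
  proof (induction F)
    case empty
    have "0 * D = D * 0" by simp
    then show ?case by blast
  next
    case (insert b F)
    then obtain S where S: "S * D = D * S" "\<forall>x\<in>F. coperator_apply (S * D) x = x"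
      by blast
    \<comment> \<open>\<open>U\<close> is chosen to invert \<open>D\<close> at the defect
      \<open>(1 - S D) b\<close>, so the factor \<open>1 - U D\<close> kills what
      \<open>1 - S D\<close> leaves of \<open>b\<close>; the vectors of \<open>F\<close> are already
      killed by \<open>1 - S D\<close>.\<close>
    obtain U where U: "U * D = D * U"
        "coperator_apply (U * D) (coperator_apply (1 - S * D) b) = coperator_apply (1 - S * D) b"
      using exists_commuting_local_inverse[OF fin inj] by blast
    define S' where "S' = S + U - U * S * D"
    have comm: "S' * D = D * S'"
      unfolding S'_def using S(1) U(1) by (simp add: algebra_simps) (metis mult.assoc)
    have "1 - S' * D = (1 - U * D) * (1 - S * D)"
      unfolding S'_def using S(1) U(1) by (simp add: algebra_simps) (metis mult.assoc)
    then have eq: "coperator_apply (1 - S' * D) x =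
        coperator_apply (1 - U * D) (coperator_apply (1 - S * D) x)" for x
      by (simp add: coperator_apply_times)
    have zero: "coperator_apply V 0 = 0" for V :: "'a coperator"
      by (rule linear_0[OF linear_coperator_apply])
    have "coperator_apply (1 - S' * D) x = 0" if "x \<in> insert b F" for x
      unfolding eq using that S(2) U(2) by (auto simp: coperator_apply_simps(2,3) zero)
    then show ?case
      using comm by (intro exI[of _ S']) (simp add: coperator_apply_simps)
  qed
  from this[OF finite_Basis] obtain S
    where S: "S * D = D * S" "\<forall>x\<in>B. coperator_apply (S * D) x = x"
    by blast
  have "S * D = 1"
  proof (rule coperator_eqI, rule linear_eq_on[OF linear_coperator_apply linear_coperator_apply])
    show "x \<in> span B" for x
      by (simp add: span_Basis)
  qed (use S(2) in \<open>simp add: coperator_apply_simps\<close>)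
  with S(1) show ?thesis
    unfolding algebra_invertible_def by metis
qed

lemma surjective_coperator_injective:
  fixes D :: "'a::complex_banach coperator"
  assumes "finite_dimensional_vector_space (scaleC :: complex \<Rightarrow> 'a \<Rightarrow> 'a) B"
    and "surj (coperator_apply D)"
  shows "inj (coperator_apply D)"
  by (rule finite_dimensional_vector_space.linear_surj_imp_inj[OF assms(1) linear_coperator_apply assms(2)])

lemma algebra_invertible_coperator_bij:
  assumes "algebra_invertible D"
  shows "bij (coperator_apply D)"
proof -
  from assms obtain S where "D * S = 1" "S * D = 1"
    unfolding algebra_invertible_def by blast
  then show ?thesis
    by (intro o_bij[of "coperator_apply S"])
      (simp_all add: fun_eq_iff coperator_apply_simps flip: coperator_apply_times)
qed

section \<open>Ranges and null spaces against bijectivity of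
  \<open>T T\<^sup>\<dagger> - T\<^sup>\<dagger> T\<close>\<close>

theorem proposition2p8:
  fixes T :: "'a::complex_banach coperator"
  assumes "\<exists>B. finite_dimensional_vector_space (scaleC :: complex \<Rightarrow> 'a \<Rightarrow> 'a) B"
    and "Moore_Penrose_invertible T"
  shows "(co_EP T \<longleftrightarrow>
      range_space T \<inter> range_space (T\<^sup>\<dagger>) = {0} \<and> null_space T \<inter> null_space (T\<^sup>\<dagger>) = {0}) \<and>
    (co_EP T \<longleftrightarrow>
      UNIV = range_space T + range_space (T\<^sup>\<dagger>) \<and> UNIV = null_space T + null_space (T\<^sup>\<dagger>))"
proof -
  obtain B where fin: "finite_dimensional_vector_space (scaleC :: complex \<Rightarrow> 'a \<Rightarrow> 'a) B"
    using assms(1) by blast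
  interpret finite_dimensional_vector_space "scaleC :: complex \<Rightarrow> 'a \<Rightarrow> 'a" B
    by (rule fin)
  interpret vector_space_pair "scaleC :: complex \<Rightarrow> 'a \<Rightarrow> 'a" "scaleC :: complex \<Rightarrow> 'a \<Rightarrow> 'a"
    by unfold_locales
  define t s where "t = coperator_apply T" and "s = coperator_apply (T\<^sup>\<dagger>)"
  define D where "D = T * T\<^sup>\<dagger> - T\<^sup>\<dagger> * T"
  define d where "d = coperator_apply D"
  have d: "d x = t (s x) - s (t x)" for x
    by (simp add: d_def D_def t_def s_def coperator_apply_simps coperator_apply_times)
  have "T * T\<^sup>\<dagger> * T = T" "T\<^sup>\<dagger> * T * T\<^sup>\<dagger> = T\<^sup>\<dagger>"
    using is_Moore_Penrose_inverse_dagger[OF assms(2)] by (simp_all add: is_Moore_Penrose_inverse_def)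
  then have tst: "t (s (t x)) = t x" and sts: "s (t (s x)) = s x" for x
    unfolding t_def s_def by (metis coperator_apply_times)+
  note lin = linear_0[OF linear_coperator_apply] linear_add[OF linear_coperator_apply]
    linear_diff[OF linear_coperator_apply]
  note lin_t = lin[of T, folded t_def] and lin_s = lin[of "T\<^sup>\<dagger>", folded s_def]
    and lin_d = lin[of D, folded d_def]
  have R: "range_space T = range t" "range_space (T\<^sup>\<dagger>) = range s"
    and N: "null_space T = {x. t x = 0}" "null_space (T\<^sup>\<dagger>) = {x. s x = 0}"
    by (simp_all add: range_space_def null_space_def t_def s_def)
  have coEP_bij: "bij d" if "co_EP T"
    using that algebra_invertible_coperator_bij by (auto simp: co_EP_def d_def D_def)
  have inj_coEP: "co_EP T" if "inj d"
    using injective_coperator_invertible[OF fin] that assms(2) by (simp add: co_EP_def d_def D_def)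
  have surj_coEP: "co_EP T" if "surj d"
    using inj_coEP surjective_coperator_injective[OF fin] that by (simp add: d_def)

  have "range t \<inter> range s = {0} \<and> {x. t x = 0} \<inter> {x. s x = 0} = {0}" if "co_EP T"
  proof -
    have d0: "x = 0" if "d x = 0" for x
      using bij_is_inj[OF coEP_bij[OF \<open>co_EP T\<close>]] that lin_d(1) by (metis injD)
    have "x = 0" if "x \<in> range t" "x \<in> range s" for x
    proof (rule d0)
      \<comment> \<open>The idempotents \<open>P\<close> and \<open>Q\<close> act as the identity on
        their own ranges.\<close>
      have "t (s x) = x" "s (t x) = x"
        using that tst sts by auto
      then show "d x = 0"
        by (simp add: d)
    qed
    moreover have "x = 0" if "t x = 0" "s x = 0" for x
      by (rule d0) (simp add: d that lin_t(1) lin_s(1))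
    moreover have "0 \<in> range t" "0 \<in> range s"
      using rangeI[of t 0] rangeI[of s 0] by (simp_all add: lin_t(1) lin_s(1))
    ultimately show ?thesis
      using lin_t(1) lin_s(1) by blast
  qed
  moreover have "co_EP T"
    if R0: "range t \<inter> range s = {0}" and N0: "{x. t x = 0} \<inter> {x. s x = 0} = {0}"
  proof (rule inj_coEP, rule injI)
    fix x y assume "d x = d y"
    then have eq: "t (s (x - y)) = s (t (x - y))"
      by (simp add: d lin_t lin_s algebra_simps)
    then have "t (s (x - y)) \<in> range t \<inter> range s"
      by (metis IntI rangeI)
    with R0 eq have "t (s (x - y)) = 0" "s (t (x - y)) = 0"
      by auto
    \<comment> \<open>\<open>P\<close> and \<open>Q\<close> have the null spaces of \<open>s\<close>
      and \<open>t\<close>: apply \<open>s t s = s\<close> and \<open>t s t = t\<close>.\<close>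
    then have "s (x - y) = 0" "t (x - y) = 0"
      using tst[of "x - y"] sts[of "x - y"] lin_t(1) lin_s(1) by auto
    with N0 have "x - y = 0"
      by blast
    then show "x = y"
      by simp
  qed
  moreover have "UNIV = range t + range s \<and> UNIV = {x. t x = 0} + {x. s x = 0}" if "co_EP T"
  proof -
    have "y \<in> range t + range s \<and> y \<in> {x. t x = 0} + {x. s x = 0}" for y
    proof -
      obtain x where x: "y = d x"
        using bij_is_surj[OF coEP_bij[OF \<open>co_EP T\<close>]] by (metis surjD)
      \<comment> \<open>The minus sign of \<open>d x\<close> moves into the argument, so that both
        summands are visibly in the ranges.\<close>
      have "t (s x) + s (t (- x)) \<in> range t + range s"
        by (intro set_plus_intro rangeI)
      moreover have "t (s x) + s (t (- x)) = y"
        using lin_t(1) lin_s(1) lin_t(3)[of 0 x] lin_s(3)[of 0 "t x"] by (simp add: x d)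
      moreover have "(x - s (t x)) + (t (s x) - x) \<in> {x. t x = 0} + {x. s x = 0}"
        by (rule set_plus_intro) (simp_all add: lin_t lin_s tst sts)
      moreover have "(x - s (t x)) + (t (s x) - x) = y"
        by (simp add: x d)
      ultimately show ?thesis
        by simp
    qed
    then show ?thesis
      by blast
  qed
  moreover have "co_EP T"
    if Rs: "UNIV = range t + range s" and Ns: "UNIV = {x. t x = 0} + {x. s x = 0}"
  proof (rule surj_coEP, unfold surj_def, rule allI)
    fix y
    have split: "\<exists>u v. x = u + v \<and> t u = 0 \<and> s v = 0" for x
    proof -
      have "x \<in> {x. t x = 0} + {x. s x = 0}"
        unfolding Ns[symmetric] by (rule UNIV_I)
      then show ?thesis
        by (auto elim!: set_plus_elim)
    qed
    have "y \<in> range t + range s"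
      unfolding Rs[symmetric] by (rule UNIV_I)
    then obtain a b where y: "y = t a + s b"
      by (auto elim: set_plus_elim)
    obtain u v where u: "t a = u + v" "t u = 0" "s v = 0"
      using split by blast
    obtain u' v' where v': "s b = u' + v'" "t u' = 0" "s v' = 0"
      using split by blast
    \<comment> \<open>\<open>P\<close> kills \<open>v\<close> and \<open>Q\<close> kills
      \<open>u\<close>, so \<open>P (t a) = P u = d u\<close>; likewise
      \<open>Q (s b) = Q v' = - d v'\<close>. The left sides are \<open>t a\<close> and
      \<open>s b\<close> themselves, which gives the preimage \<open>u - v'\<close> of
      \<open>y\<close>.\<close>
    have "t (s (t a)) = d u" "s (t (s b)) = - d v'"
      unfolding u(1) v'(1) by (simp_all add: d lin_t lin_s u v')
    then have "y = d (u - v')"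
      by (simp add: y tst sts lin_d)
    then show "\<exists>x. y = d x" ..
  qed
  ultimately show ?thesis
    unfolding R N by blast
qed

end
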